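(* Let $h>0$ and let $\mathbf{S}$ be any candidate order of $M\ge1$ transmitters and $N\ge1$ receivers. Under the constraint $\|H_lH_r\|=h$, there exist unique spacings $\mathbf{D}_{\mathbf{S}}$ such that $\mathbf{D}_{\mathbf{S}}$ is balanced.
   Context: All points lie on a line. There are $M\ge1$ transmitters (type $T$) and $N\ge1$ receivers (type $R$), $J=M+N$, and two virtual end nodes $H_l$ (leftmost) and $H_r$ (rightmost). A (deployment) order is a sequence $\mathbf{S}=(H_l,S_1,\dots,S_J,H_r)$ where $(S_1,\dots,S_J)$ is a permutation of the set of all transmitters and receivers, listed from left to right: $0\le\|H_lS_1\|\le\cdots\le\|H_lS_J\|\le\|H_lH_r\|$. Its spacings are the nonnegative distances between neighbors, $\mathbf{D}_{\mathbf{S}}=(\|H_lS_1\|,\|S_1S_2\|,\dots,\|S_{J-1}S_J\|,\|S_JH_r\|)$; order plus spacings determine all locations. For a point $p$, $I(p)$ is the minimum of $\|T_ip\|\,\|R_jp\|$ over all transmitters $T_i$ and receivers $R_j$. The local vulnerable points are $H_l$, $H_r$ and the midpoints of $\overline{S_iS_{i+1}}$ for $i=1,\dots,J-1$; the local vulnerable values are the values of $I$ there. The spacings are balanced if all local vulnerable values are equal. A candidate order is an order $\mathbf{S}$ in which no block of consecutive nodes has (as sequence of node types) any of the patterns $(T,T,R,R)$, $(R,R,T,T)$, $(T,T,R,H_r)$, $(R,R,T,H_r)$, $(H_l,T,R,R)$, $(H_l,R,T,T)$. *)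

theory Defs
  imports Complex_Main "HOL-Library.Sublist"
begin

datatype node = Hl | Hr | Tx nat | Rx nat

datatype node_kind = KHl | KHr | KT | KR

fun kind_of :: "node \<Rightarrow> node_kind" where
  "kind_of Hl = KHl"
| "kind_of Hr = KHr"
| "kind_of (Tx i) = KT"
| "kind_of (Rx j) = KR"

text \<open>An order lists the nodes from left to right, end nodes included. So \<open>S ! 0 = Hl\<close>,
  \<open>S ! (M + N + 1) = Hr\<close>, and \<open>S ! 1, \<dots>, S ! (M + N)\<close> enumerate all transmitters and receivers.\<close>

definition is_order :: "nat \<Rightarrow> nat \<Rightarrow> node list \<Rightarrow> bool" where
  "is_order M N S \<longleftrightarrow>
    (\<exists>ss. S = Hl # ss @ [Hr] \<and> distinct ss \<and> set ss = Tx ` {1..M} \<union> Rx ` {1..N})"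

text \<open>The library predicate \<open>sublist\<close> means a contiguous block.\<close>

definition candidate_order :: "nat \<Rightarrow> nat \<Rightarrow> node list \<Rightarrow> bool" where
  "candidate_order M N S \<longleftrightarrow> is_order M N S \<and>
    (\<forall>p \<in> {[KT, KT, KR, KR], [KR, KR, KT, KT],
           [KT, KT, KR, KHr], [KR, KR, KT, KHr],
           [KHl, KT, KR, KR], [KHl, KR, KT, KT]}.
       \<not> sublist p (map kind_of S))"

text \<open>\<open>D ! k\<close> is the distance between \<open>S ! k\<close> and \<open>S ! (k + 1)\<close>. Zero spacings are allowed.\<close>

definition is_spacings :: "node list \<Rightarrow> real list \<Rightarrow> bool" where
  "is_spacings S D \<longleftrightarrow> length D + 1 = length S \<and> (\<forall>d \<in> set D. 0 \<le> d)"

text \<open>The coordinate of \<open>S ! k\<close> on the line, with the origin placed at \<open>Hl\<close>.\<close>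

definition loc :: "real list \<Rightarrow> nat \<Rightarrow> real" where
  "loc D k = sum_list (take k D)"

definition I_val :: "node list \<Rightarrow> real list \<Rightarrow> real \<Rightarrow> real" where
  "I_val S D p = Min {\<bar>loc D a - p\<bar> * \<bar>loc D b - p\<bar> | a b.
     a < length S \<and> b < length S \<and> kind_of (S ! a) = KT \<and> kind_of (S ! b) = KR}"

text \<open>The bounds on \<open>i\<close> exclude the two segments that touch an end node.\<close>

definition local_vulnerable_points :: "node list \<Rightarrow> real list \<Rightarrow> real set" where
  "local_vulnerable_points S D =
     {loc D 0, loc D (length S - 1)} \<union>
     {(loc D i + loc D (i + 1)) / 2 | i. 1 \<le> i \<and> i + 2 < length S}"

definition balanced :: "node list \<Rightarrow> real list \<Rightarrow> bool" where
  "balanced S D \<longleftrightarrow>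
     (\<forall>p \<in> local_vulnerable_points S D. \<forall>q \<in> local_vulnerable_points S D.
        I_val S D p = I_val S D q)"

end

theory Submission
  imports Defs
begin

text \<open>Call a gap between neighbouring sensors a \<^emph>\<open>change\<close> if it separates a transmitter from a
  receiver, and let \<open>r\<close> be the rank of a gap: its distance, counted in gaps, to the nearest change.
  Let \<open>u\<close> be the distance from a local vulnerable point to its nearest sensors (half the spacing
  inside, the whole spacing at the two ends). The value there is \<open>u * (u + \<sigma>)\<close>, where \<open>\<sigma>\<close> is
  the least total length of the gaps leading to, and including, a change. If the common value is
  \<open>w\<^sup>2\<close>, induction on \<open>r\<close> gives \<open>u = w * (sqrt (r + 1) - sqrt r)\<close>: the lengths of the gaps on the
  way telescope to \<open>\<sigma> = 2 * w * sqrt r\<close>, and \<open>u * (u + 2 * w * sqrt r) = w\<^sup>2\<close> has only that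
  nonnegative root. So balanced spacings are determined up to the factor \<open>w\<close>, which \<open>h\<close> fixes.\<close>

section \<open>Differences of consecutive square roots\<close>

definition sqrt_step :: "nat \<Rightarrow> real" where
  "sqrt_step n = sqrt (real (Suc n)) - sqrt (real n)"

lemma sqrt_step_pos: "0 < sqrt_step n"
  by (simp add: sqrt_step_def)

lemma sum_sqrt_step: "(\<Sum>t<n. sqrt_step t) = sqrt (real n)"
  by (induction n) (simp_all add: sqrt_step_def)

text \<open>Rationalised form; its denominator visibly grows with \<open>n\<close>, which gives the
  monotonicity below.\<close>

lemma sqrt_step_eq: "sqrt_step n = 1 / (sqrt (real (Suc n)) + sqrt (real n))"
proof -
  have "sqrt_step n * (sqrt (real (Suc n)) + sqrt (real n)) = 1"
    by (simp add: sqrt_step_def algebra_simps)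
  moreover have "0 < sqrt (real (Suc n)) + sqrt (real n)"
    by (simp add: add_pos_nonneg)
  ultimately show ?thesis
    by (simp add: field_simps)
qed

lemma sqrt_step_antimono:
  assumes "m \<le> n"
  shows "sqrt_step n \<le> sqrt_step m"
proof -
  have "0 < sqrt (real (Suc m)) + sqrt (real m)"
    by (simp add: add_pos_nonneg)
  moreover have "sqrt (real (Suc m)) + sqrt (real m) \<le> sqrt (real (Suc n)) + sqrt (real n)"
    using assms by (intro add_mono) simp_all
  ultimately show ?thesis
    unfolding sqrt_step_eq by (simp add: frac_le)
qed

text \<open>Completing the square: adding \<open>w\<^sup>2 * n\<close> to both sides gives an
  equation of two squares with nonnegative bases, so the bases agree.\<close>

lemma quadratic_sqrt_step:
  fixes u w :: real
  assumes "0 \<le> u" "0 \<le> w"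
  shows "u * (u + 2 * w * sqrt (real n)) = w\<^sup>2 \<longleftrightarrow> u = w * sqrt_step n"
proof -
  have "u * (u + 2 * w * sqrt (real n)) = w\<^sup>2 \<longleftrightarrow>
      (u + w * sqrt (real n))\<^sup>2 = (w * sqrt (real (Suc n)))\<^sup>2"
    by (simp add: power2_eq_square algebra_simps)
  also have "\<dots> \<longleftrightarrow> u + w * sqrt (real n) = w * sqrt (real (Suc n))"
    using assms by (intro power2_eq_iff_nonneg) simp_all
  also have "\<dots> \<longleftrightarrow> u = w * sqrt_step n"
    by (auto simp: sqrt_step_def algebra_simps)
  finally show ?thesis .
qed

section \<open>Locations as partial sums of spacings\<close>

lemma loc_eq_sum: "k \<le> length D \<Longrightarrow> loc D k = sum ((!) D) {..<k}"
  by (simp add: loc_def sum_list_sum_nth atLeast0LessThan)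

lemma loc_diff:
  assumes "j \<le> k" "k \<le> length D"
  shows "loc D k - loc D j = sum ((!) D) {j..<k}"
proof -
  have "{..<k} = {..<j} \<union> {j..<k}"
    using assms by auto
  then have "sum ((!) D) {..<k} = sum ((!) D) {..<j} + sum ((!) D) {j..<k}"
    by (simp add: sum.union_disjoint ivl_disj_int)
  then show ?thesis
    using assms by (simp add: loc_eq_sum)
qed

section \<open>Types of nodes by position, changes and ranks\<close>

locale sensor_line =
  fixes S :: "node list" and J :: nat
  assumes length_S: "length S = J + 2"
    and kind_sensor: "\<And>i. 1 \<le> i \<Longrightarrow> i \<le> J \<Longrightarrow> kind_of (S ! i) = KT \<or> kind_of (S ! i) = KR"
    and kind_first: "kind_of (S ! 0) = KHl"
    and kind_last: "kind_of (S ! (J + 1)) = KHr"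
    and ex_transmitter: "\<exists>i. 1 \<le> i \<and> i \<le> J \<and> kind_of (S ! i) = KT"
    and ex_receiver: "\<exists>i. 1 \<le> i \<and> i \<le> J \<and> kind_of (S ! i) = KR"
begin

text \<open>Gap \<open>i\<close> is the one between \<open>S ! i\<close> and
  \<open>S ! Suc i\<close>, of length \<open>D ! i\<close>. The end gaps \<open>0\<close> and
  \<open>J\<close> are excluded here.\<close>

definition changes :: "nat set" where
  "changes = {c. 1 \<le> c \<and> c < J \<and> kind_of (S ! c) \<noteq> kind_of (S ! Suc c)}"

text \<open>Subtraction on \<open>nat\<close> is truncated, so \<open>(i - c) + (c - i)\<close> is the distance of \<open>i\<close> and \<open>c\<close>.\<close>

definition rank :: "nat \<Rightarrow> nat" where
  "rank i = Min ((\<lambda>c. (i - c) + (c - i)) ` changes)"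

definition radius :: "real list \<Rightarrow> nat \<Rightarrow> real" where
  "radius D i = (if i = 0 \<or> i = J then D ! i else D ! i / 2)"

text \<open>Each gap gets exactly one local vulnerable point, an end gap its end node. So there is
  one equation per unknown spacing.\<close>

definition vpoint :: "real list \<Rightarrow> nat \<Rightarrow> real" where
  "vpoint D i = (if i = 0 then loc D 0 else if i = J then loc D (J + 1)
     else (loc D i + loc D (i + 1)) / 2)"

text \<open>The balanced spacings with common value 1; the factor 2 undoes the halving in
  \<open>radius\<close>.\<close>

definition profile :: "nat \<Rightarrow> real" where
  "profile i = (if i = 0 \<or> i = J then 1 else 2) * sqrt_step (rank i)"

text \<open>One of the two intervals is empty.\<close>

definition reach :: "real list \<Rightarrow> nat \<Rightarrow> nat \<Rightarrow> real" where
  "reach D i c = sum ((!) D) {c..<i} + sum ((!) D) {i<..c}"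

lemma sensor_index:
  assumes "a < length S" "kind_of (S ! a) = KT \<or> kind_of (S ! a) = KR"
  shows "1 \<le> a" "a \<le> J"
proof -
  have "a \<noteq> 0" "a \<noteq> J + 1"
    using assms(2) kind_first kind_last by (metis node_kind.distinct)+
  then show "1 \<le> a" "a \<le> J"
    using assms(1) length_S by auto
qed

text \<open>Discrete intermediate value argument: if the type first differs from that of
  \<open>a\<close> on stepping from \<open>b\<close> to \<open>Suc b\<close>, then gap
  \<open>b\<close> is a change; otherwise an earlier gap is one.\<close>

lemma change_between:
  assumes "1 \<le> a" "a \<le> b" "b \<le> J" "kind_of (S ! a) \<noteq> kind_of (S ! b)"
  shows "\<exists>c\<in>changes. a \<le> c \<and> c < b"
  using assms(2,1,3,4)
proof (induction b rule: dec_induct)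
  case base
  then show ?case by simp
next
  case (step b)
  show ?case
  proof (cases "kind_of (S ! a) = kind_of (S ! b)")
    case True
    then have "b \<in> changes"
      using step by (auto simp: changes_def)
    then show ?thesis
      using step by auto
  next
    case False
    then show ?thesis
      using step by (auto intro: less_SucI)
  qed
qed

lemma finite_changes: "finite changes"
  by (simp add: changes_def)

lemma changes_nonempty: "changes \<noteq> {}"
proof -
  obtain a b where ab: "1 \<le> a" "a \<le> J" "kind_of (S ! a) = KT" "1 \<le> b" "b \<le> J" "kind_of (S ! b) = KR"
    using ex_transmitter ex_receiver by blast
  then show ?thesis
    using change_between[of a b] change_between[of b a] by (cases "a \<le> b") auto
qed

lemma two_le_J: "2 \<le> J"
  using changes_nonempty by (auto simp: changes_def)

lemma rank_le: "c \<in> changes \<Longrightarrow> rank i \<le> (i - c) + (c - i)"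
  unfolding rank_def using finite_changes by (intro Min_le) auto

lemma rank_attained: "\<exists>c\<in>changes. rank i = (i - c) + (c - i)"
proof -
  have "rank i \<in> (\<lambda>c. (i - c) + (c - i)) ` changes"
    unfolding rank_def using finite_changes changes_nonempty by (intro Min_in) auto
  then show ?thesis by auto
qed

text \<open>Triangle inequality through a change nearest to \<open>j\<close>.\<close>

lemma rank_lipschitz: "rank i \<le> rank j + ((i - j) + (j - i))"
proof -
  obtain c where c: "c \<in> changes" "rank j = (j - c) + (c - j)"
    using rank_attained by blast
  show ?thesis
    using rank_le[OF c(1), of i] c(2) by linarith
qed

section \<open>Distances from vulnerable points to sensors\<close>

lemma spacings_nonneg: "is_spacings S D \<Longrightarrow> i \<le> J \<Longrightarrow> 0 \<le> D ! i"
  using length_S by (auto simp: is_spacings_def)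

lemma length_spacings: "is_spacings S D \<Longrightarrow> length D = J + 1"
  using length_S by (simp add: is_spacings_def)

lemma radius_nonneg: "is_spacings S D \<Longrightarrow> i \<le> J \<Longrightarrow> 0 \<le> radius D i"
  by (simp add: radius_def spacings_nonneg)

lemma sum_spacings_mono:
  assumes "is_spacings S D" "A \<subseteq> B" "B \<subseteq> {..J}"
  shows "sum ((!) D) A \<le> sum ((!) D) B"
proof (rule sum_mono2)
  show "finite B"
    using assms(3) finite_subset by blast
  show "A \<subseteq> B"
    by (fact assms(2))
  show "0 \<le> D ! b" if "b \<in> B - A" for b
    using that assms spacings_nonneg by auto
qed

lemma sum_spacings_nonneg: "is_spacings S D \<Longrightarrow> B \<subseteq> {..J} \<Longrightarrow> 0 \<le> sum ((!) D) B"
  using sum_spacings_mono[of D "{}" B] by simp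

text \<open>Gap \<open>i\<close> itself contributes only \<open>radius D i\<close>, the gaps from
  \<open>a\<close> up to it their full length. The bounds force \<open>1 \<le> i\<close>: no sensor
  has an index on the left of gap \<open>0\<close>.\<close>

lemma dist_vpoint_left:
  assumes "is_spacings S D" "1 \<le> a" "a \<le> i" "i \<le> J"
  shows "\<bar>loc D a - vpoint D i\<bar> = radius D i + sum ((!) D) {a..<i}"
proof -
  have len: "length D = J + 1"
    using assms(1) by (rule length_spacings)
  have 1: "loc D i - loc D a = sum ((!) D) {a..<i}"
    using assms len by (intro loc_diff) auto
  have 2: "loc D (i + 1) - loc D i = D ! i"
    using loc_diff[of i "i + 1" D] assms len by simp
  have "vpoint D i - loc D a = radius D i + sum ((!) D) {a..<i}"
    using 1 2 assms by (auto simp: vpoint_def radius_def field_simps)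
  moreover have "0 \<le> radius D i + sum ((!) D) {a..<i}"
    using assms by (intro add_nonneg_nonneg radius_nonneg sum_spacings_nonneg) auto
  ultimately show ?thesis by linarith
qed

lemma dist_vpoint_right:
  assumes "is_spacings S D" "i < b" "b \<le> J"
  shows "\<bar>loc D b - vpoint D i\<bar> = radius D i + sum ((!) D) {i<..<b}"
proof -
  have len: "length D = J + 1"
    using assms(1) by (rule length_spacings)
  have 1: "loc D b - loc D (i + 1) = sum ((!) D) {i<..<b}"
    using loc_diff[of "i + 1" b D] assms len
    by (simp add: atLeastSucLessThan_greaterThanLessThan)
  have 2: "loc D (i + 1) - loc D i = D ! i"
    using loc_diff[of i "i + 1" D] assms len by simp
  have "loc D b - vpoint D i = radius D i + sum ((!) D) {i<..<b}"
    using 1 2 assms by (auto simp: vpoint_def radius_def field_simps)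
  moreover have "0 \<le> radius D i + sum ((!) D) {i<..<b}"
    using assms by (intro add_nonneg_nonneg radius_nonneg sum_spacings_nonneg) auto
  ultimately show ?thesis by linarith
qed

section \<open>The value of \<open>I_val\<close> at a vulnerable point\<close>

lemma finite_I_val_set:
  "finite {\<bar>loc D a - p\<bar> * \<bar>loc D b - p\<bar> | a b.
     a < length S \<and> b < length S \<and> kind_of (S ! a) = KT \<and> kind_of (S ! b) = KR}"
  by (rule finite_subset[where B = "(\<lambda>(a, b). \<bar>loc D a - p\<bar> * \<bar>loc D b - p\<bar>) `
      ({..<length S} \<times> {..<length S})"]) auto

text \<open>Between a transmitter and a receiver there is always a change, so by
  \<open>across\<close> one of the two factors is at least \<open>v\<close>, while
  \<open>lower\<close> bounds the other by \<open>u\<close>. The pair \<open>a\<close>,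
  \<open>b\<close> attains the bound.\<close>

lemma I_val_eqI:
  assumes sensors: "1 \<le> a" "a \<le> J" "1 \<le> b" "b \<le> J" "kind_of (S ! a) \<noteq> kind_of (S ! b)"
    and near: "\<bar>loc D a - p\<bar> = u" and far: "\<bar>loc D b - p\<bar> = v"
    and lower: "\<And>a. 1 \<le> a \<Longrightarrow> a \<le> J \<Longrightarrow> u \<le> \<bar>loc D a - p\<bar>"
    and across: "\<And>a b c. c \<in> changes \<Longrightarrow> 1 \<le> a \<Longrightarrow> a \<le> c \<Longrightarrow> c < b \<Longrightarrow> b \<le> J \<Longrightarrow>
      v \<le> \<bar>loc D a - p\<bar> \<or> v \<le> \<bar>loc D b - p\<bar>"
  shows "I_val S D p = u * v"
  unfolding I_val_def
proof (rule Min_eqI[OF finite_I_val_set])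
  have uv: "0 \<le> u" "0 \<le> v"
    using near far by auto
  \<comment> \<open>The pair is ordered by position rather than by type, as
    \<open>change_between\<close> requires; the product is symmetric.\<close>
  have *: "u * v \<le> \<bar>loc D a' - p\<bar> * \<bar>loc D b' - p\<bar>"
    if ab: "1 \<le> a'" "a' \<le> b'" "b' \<le> J" and ne: "kind_of (S ! a') \<noteq> kind_of (S ! b')" for a' b'
  proof -
    obtain c where c: "c \<in> changes" "a' \<le> c" "c < b'"
      using change_between[OF ab ne] by blast
    have l: "u \<le> \<bar>loc D a' - p\<bar>" "u \<le> \<bar>loc D b' - p\<bar>"
      using lower that by auto
    from across[OF c(1) \<open>1 \<le> a'\<close> c(2,3) \<open>b' \<le> J\<close>] show ?thesis
    proof
      assume "v \<le> \<bar>loc D a' - p\<bar>"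
      then have "v * u \<le> \<bar>loc D a' - p\<bar> * \<bar>loc D b' - p\<bar>"
        using l uv by (intro mult_mono) auto
      then show ?thesis by (simp add: mult.commute)
    next
      assume "v \<le> \<bar>loc D b' - p\<bar>"
      then show ?thesis
        using l uv by (intro mult_mono) auto
    qed
  qed
  show "u * v \<le> y" if y: "y \<in> {\<bar>loc D a - p\<bar> * \<bar>loc D b - p\<bar> | a b.
     a < length S \<and> b < length S \<and> kind_of (S ! a) = KT \<and> kind_of (S ! b) = KR}" for y
  proof -
    obtain a' b' where y': "y = \<bar>loc D a' - p\<bar> * \<bar>loc D b' - p\<bar>" "a' < length S" "b' < length S"
      "kind_of (S ! a') = KT" "kind_of (S ! b') = KR"
      using y by blast
    have "1 \<le> a'" "a' \<le> J" "1 \<le> b'" "b' \<le> J"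
      using sensor_index y' by auto
    then show ?thesis
      using *[of a' b'] *[of b' a'] y' by (cases "a' \<le> b'") (auto simp: mult.commute)
  qed
  have len: "a < length S" "b < length S"
    using sensors length_S by auto
  have "kind_of (S ! a) = KT \<and> kind_of (S ! b) = KR \<or> kind_of (S ! a) = KR \<and> kind_of (S ! b) = KT"
    using sensors kind_sensor by metis
  then show "u * v \<in> {\<bar>loc D a - p\<bar> * \<bar>loc D b - p\<bar> | a b.
     a < length S \<and> b < length S \<and> kind_of (S ! a) = KT \<and> kind_of (S ! b) = KR}"
  proof
    assume "kind_of (S ! a) = KT \<and> kind_of (S ! b) = KR"
    then show ?thesis
      using len near far by blast
  next
    assume k: "kind_of (S ! a) = KR \<and> kind_of (S ! b) = KT"
    have "u * v = \<bar>loc D b - p\<bar> * \<bar>loc D a - p\<bar>"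
      using near far by simp
    then show ?thesis
      using len k by blast
  qed
qed

text \<open>A further change strictly between gap \<open>i\<close> and \<open>c\<close> would be
  nearer than the rank allows. So the type stays constant on the way to \<open>c\<close> and flips
  exactly there.\<close>

lemma nearest_change_kinds:
  assumes c: "c \<in> changes" "rank i = (i - c) + (c - i)" and i: "i \<le> J"
  shows "c < i \<Longrightarrow> kind_of (S ! i) \<noteq> kind_of (S ! c)"
    and "i < c \<Longrightarrow> kind_of (S ! Suc i) \<noteq> kind_of (S ! Suc c)"
proof -
  have c': "1 \<le> c" "c < J" "kind_of (S ! c) \<noteq> kind_of (S ! Suc c)"
    using c by (auto simp: changes_def)
  show "kind_of (S ! i) \<noteq> kind_of (S ! c)" if "c < i"
  proof -
    have "kind_of (S ! Suc c) = kind_of (S ! i)"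
    proof (rule ccontr)
      assume "kind_of (S ! Suc c) \<noteq> kind_of (S ! i)"
      then obtain c2 where "c2 \<in> changes" "Suc c \<le> c2" "c2 < i"
        using change_between[of "Suc c" i] \<open>c < i\<close> i by auto
      then show False
        using rank_le[of c2 i] c(2) by linarith
    qed
    then show ?thesis
      using c' by simp
  qed
  show "kind_of (S ! Suc i) \<noteq> kind_of (S ! Suc c)" if "i < c"
  proof -
    have "kind_of (S ! Suc i) = kind_of (S ! c)"
    proof (rule ccontr)
      assume "kind_of (S ! Suc i) \<noteq> kind_of (S ! c)"
      then obtain c2 where "c2 \<in> changes" "Suc i \<le> c2" "c2 < c"
        using change_between[of "Suc i" c] \<open>i < c\<close> c' by auto
      then show False
        using rank_le[of c2 i] c(2) by linarith
    qed
    then show ?thesis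
      using c' by simp
  qed
qed

text \<open>One sensor next to gap \<open>i\<close> is at distance \<open>radius D i\<close>, and
  the first sensor beyond \<open>c\<close> has the other type. Since \<open>c\<close> is nearest by
  count and also least by \<open>reach\<close>, no pair does better.\<close>

lemma I_val_vpoint:
  assumes D: "is_spacings S D" and i: "i \<le> J"
    and c: "c \<in> changes" "rank i = (i - c) + (c - i)"
    and least: "\<And>c'. c' \<in> changes \<Longrightarrow> reach D i c \<le> reach D i c'"
  shows "I_val S D (vpoint D i) = radius D i * (radius D i + reach D i c)"
proof -
  have c': "1 \<le> c" "c < J" "kind_of (S ! c) \<noteq> kind_of (S ! Suc c)"
    using c by (auto simp: changes_def)
  have lower: "radius D i \<le> \<bar>loc D a - vpoint D i\<bar>" if "1 \<le> a" "a \<le> J" for a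
  proof (cases "a \<le> i")
    case True
    then have "\<bar>loc D a - vpoint D i\<bar> = radius D i + sum ((!) D) {a..<i}"
      using D i that by (intro dist_vpoint_left)
    moreover have "0 \<le> sum ((!) D) {a..<i}"
      using D i by (intro sum_spacings_nonneg) auto
    ultimately show ?thesis by simp
  next
    case False
    then have "\<bar>loc D a - vpoint D i\<bar> = radius D i + sum ((!) D) {i<..<a}"
      using D i that by (intro dist_vpoint_right) auto
    moreover have "0 \<le> sum ((!) D) {i<..<a}"
      using D that by (intro sum_spacings_nonneg) auto
    ultimately show ?thesis by simp
  qed
  \<comment> \<open>A change at or left of gap \<open>i\<close> puts \<open>a\<close> beyond it, a
    change on the right puts \<open>b\<close> beyond it; that sensor pays at least the
    \<open>reach\<close> of the change.\<close>
  have across: "radius D i + reach D i c \<le> \<bar>loc D a - vpoint D i\<bar> \<or>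
      radius D i + reach D i c \<le> \<bar>loc D b - vpoint D i\<bar>"
    if "c2 \<in> changes" "1 \<le> a" "a \<le> c2" "c2 < b" "b \<le> J" for a b c2
  proof (cases "c2 \<le> i")
    case True
    then have "\<bar>loc D a - vpoint D i\<bar> = radius D i + sum ((!) D) {a..<i}"
      using D i that by (intro dist_vpoint_left) auto
    moreover have "sum ((!) D) {c2..<i} \<le> sum ((!) D) {a..<i}"
      using D i that by (intro sum_spacings_mono) auto
    moreover have "reach D i c2 = sum ((!) D) {c2..<i}"
      using True by (simp add: reach_def)
    ultimately show ?thesis
      using least[OF that(1)] by linarith
  next
    case False
    then have "\<bar>loc D b - vpoint D i\<bar> = radius D i + sum ((!) D) {i<..<b}"
      using D i that by (intro dist_vpoint_right) auto
    moreover have "sum ((!) D) {i<..c2} \<le> sum ((!) D) {i<..<b}"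
      using D i that by (intro sum_spacings_mono) auto
    moreover have "reach D i c2 = sum ((!) D) {i<..c2}"
      using False by (simp add: reach_def)
    ultimately show ?thesis
      using least[OF that(1)] by linarith
  qed
  \<comment> \<open>The minimising pairs of positions are \<open>i\<close>, \<open>c\<close>, then
    \<open>i\<close>, \<open>Suc i\<close>, then \<open>Suc i\<close>, \<open>Suc c\<close>; in the
    middle case \<open>reach\<close> is an empty sum.\<close>
  consider "c < i" | "c = i" | "i < c" by linarith
  then show ?thesis
  proof cases
    case 1
    show ?thesis
    proof (rule I_val_eqI[of i c])
      show "kind_of (S ! i) \<noteq> kind_of (S ! c)"
        using nearest_change_kinds(1)[OF c i 1] .
      show "\<bar>loc D i - vpoint D i\<bar> = radius D i"
        using dist_vpoint_left[OF D, of i i] 1 i by simp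
      show "\<bar>loc D c - vpoint D i\<bar> = radius D i + reach D i c"
        using dist_vpoint_left[OF D, of c i] 1 i c' by (simp add: reach_def)
    qed (use 1 i c' lower across in auto)
  next
    case 2
    show ?thesis
    proof (rule I_val_eqI[of i "Suc i"])
      show "kind_of (S ! i) \<noteq> kind_of (S ! Suc i)"
        using c' 2 by simp
      show "\<bar>loc D i - vpoint D i\<bar> = radius D i"
        using dist_vpoint_left[OF D, of i i] 2 i c' by simp
      have "{i<..<Suc i} = {}" by auto
      then show "\<bar>loc D (Suc i) - vpoint D i\<bar> = radius D i + reach D i c"
        using dist_vpoint_right[OF D, of i "Suc i"] 2 c' by (simp add: reach_def)
    qed (use 2 i c' lower across in auto)
  next
    case 3
    show ?thesis
    proof (rule I_val_eqI[of "Suc i" "Suc c"])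
      show "kind_of (S ! Suc i) \<noteq> kind_of (S ! Suc c)"
        using nearest_change_kinds(2)[OF c i 3] .
      have "{i<..<Suc i} = {}" by auto
      then show "\<bar>loc D (Suc i) - vpoint D i\<bar> = radius D i"
        using dist_vpoint_right[OF D, of i "Suc i"] 3 c' by simp
      have "{i<..<Suc c} = {i<..c}" by auto
      then show "\<bar>loc D (Suc c) - vpoint D i\<bar> = radius D i + reach D i c"
        using dist_vpoint_right[OF D, of i "Suc c"] 3 c' by (simp add: reach_def)
    qed (use 3 i c' lower across in auto)
  qed
qed

section \<open>Lengths of the ways to the changes\<close>

text \<open>The gaps on the way from \<open>i\<close> to \<open>c\<close>, without \<open>i\<close>
  and with \<open>c\<close>, have the ranks \<open>rank i - 1\<close> down to 0, each once, so their
  lengths telescope.\<close>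

lemma reach_nearest:
  assumes i: "i \<le> J" and c: "c \<in> changes" "rank i = (i - c) + (c - i)"
    and inner: "\<And>j. 1 \<le> j \<Longrightarrow> j < J \<Longrightarrow> rank j < rank i \<Longrightarrow> D ! j = w * profile j"
  shows "reach D i c = 2 * w * sqrt (real (rank i))"
proof -
  define n where "n = rank i"
  have c': "1 \<le> c" "c < J"
    using c by (auto simp: changes_def)
  \<comment> \<open>Here \<open>j\<close> lies on the way, \<open>t\<close> gaps from
    \<open>c\<close> and \<open>n - t\<close> from \<open>i\<close>. The first distance bounds its
    rank by \<open>t\<close> from above, the Lipschitz property from below.\<close>
  have val: "D ! j = w * (2 * sqrt_step t)"
    if "1 \<le> j" "j < J" "(j - c) + (c - j) = t" "(i - j) + (j - i) = n - t" "t < n" for j t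
  proof -
    have "rank j \<le> t"
      using rank_le[OF c(1), of j] that by simp
    moreover have "n \<le> rank j + (n - t)"
      using rank_lipschitz[of i j] that n_def by simp
    ultimately have "rank j = t"
      using that(5) by linarith
    then show ?thesis
      using inner[of j] that by (simp add: n_def profile_def)
  qed
  have tele: "(\<Sum>t<n. w * (2 * sqrt_step t)) = 2 * w * sqrt (real n)"
    by (simp add: sum_sqrt_step flip: sum_distrib_left)
  show ?thesis
  proof (cases "c \<le> i")
    case True
    then have "n = i - c"
      using c(2) n_def by simp
    have "reach D i c = sum ((!) D) {c..<i}"
      using True by (simp add: reach_def)
    also have "\<dots> = (\<Sum>t<n. w * (2 * sqrt_step t))"
      using True c' i
      by (intro sum.reindex_bij_witness[of _ "\<lambda>t. c + t" "\<lambda>j. j - c"])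
        (auto simp: \<open>n = i - c\<close> intro!: val[symmetric])
    finally show ?thesis
      using tele n_def by simp
  next
    case False
    then have "n = c - i"
      using c(2) n_def by simp
    have "reach D i c = sum ((!) D) {i<..c}"
      using False by (simp add: reach_def)
    also have "\<dots> = (\<Sum>t<n. w * (2 * sqrt_step t))"
      using False c' i
      by (intro sum.reindex_bij_witness[of _ "\<lambda>t. c - t" "\<lambda>j. c - j"])
        (auto simp: \<open>n = c - i\<close> intro!: val[symmetric])
    finally show ?thesis
      using tele n_def by simp
  qed
qed

text \<open>A gap at distance \<open>t\<close> from \<open>c\<close> has rank at most
  \<open>t\<close>, and \<open>sqrt_step\<close> decreases, so it is at least as long as the
  matching gap on the way to a nearest change.\<close>

lemma reach_ge:
  assumes D: "is_spacings S D" and i: "i \<le> J" and c: "c \<in> changes" and w: "0 \<le> w"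
    and inner: "\<And>j. 1 \<le> j \<Longrightarrow> j < J \<Longrightarrow> rank j < rank i \<Longrightarrow> D ! j = w * profile j"
  shows "2 * w * sqrt (real (rank i)) \<le> reach D i c"
proof -
  define n where "n = rank i"
  have c': "1 \<le> c" "c < J"
    using c by (auto simp: changes_def)
  have val: "w * (2 * sqrt_step t) \<le> D ! j"
    if "1 \<le> j" "j < J" "(j - c) + (c - j) = t" "t < n" for j t
  proof -
    have "rank j \<le> t"
      using rank_le[OF c(1), of j] that by simp
    then have "sqrt_step t \<le> sqrt_step (rank j)" "rank j < n"
      using sqrt_step_antimono that by auto
    then show ?thesis
      using inner[of j] that w by (auto simp: n_def profile_def intro: mult_left_mono)
  qed
  have tele: "2 * w * sqrt (real n) = (\<Sum>t<n. w * (2 * sqrt_step t))"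
    by (simp add: sum_sqrt_step flip: sum_distrib_left)
  \<comment> \<open>The way to \<open>c\<close> has at least \<open>n\<close> gaps. Only the
    \<open>n\<close> gaps closest to \<open>c\<close> are kept, since their ranks are below
    \<open>n\<close> and \<open>inner\<close> applies; the others are just nonnegative.\<close>
  have n_le: "n \<le> (i - c) + (c - i)"
    using rank_le[OF c] n_def by simp
  show ?thesis
  proof (cases "c \<le> i")
    case True
    have "2 * w * sqrt (real n) \<le> (\<Sum>t<n. D ! (c + t))"
      unfolding tele using n_le True c' i by (intro sum_mono val) auto
    also have "\<dots> = sum ((!) D) {c..<c + n}"
      by (intro sum.reindex_bij_witness[of _ "\<lambda>j. j - c" "\<lambda>t. c + t"]) auto
    also have "\<dots> \<le> sum ((!) D) {c..<i}"
      using n_le True i by (intro sum_spacings_mono D) auto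
    also have "\<dots> = reach D i c"
      using True by (simp add: reach_def)
    finally show ?thesis
      by (simp add: n_def)
  next
    case False
    have "2 * w * sqrt (real n) \<le> (\<Sum>t<n. D ! (c - t))"
      unfolding tele using n_le False c' by (intro sum_mono val) auto
    also have "\<dots> = sum ((!) D) {c - n<..c}"
      using n_le False
      by (intro sum.reindex_bij_witness[of _ "\<lambda>j. c - j" "\<lambda>t. c - t"]) auto
    also have "\<dots> \<le> sum ((!) D) {i<..c}"
      using n_le False c' by (intro sum_spacings_mono D) auto
    also have "\<dots> = reach D i c"
      using False by (simp add: reach_def)
    finally show ?thesis
      by (simp add: n_def)
  qed
qed

section \<open>Characterisation of balanced spacings\<close>

text \<open>Induction step over ranks. Once the inner gaps of smaller rank are known, the nearest
  change by count also has the least \<open>reach\<close>, and the value depends on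
  \<open>D ! i\<close> alone through the quadratic equation.\<close>

lemma value_iff:
  assumes D: "is_spacings S D" and i: "i \<le> J" and w: "0 \<le> w"
    and inner: "\<And>j. 1 \<le> j \<Longrightarrow> j < J \<Longrightarrow> rank j < rank i \<Longrightarrow> D ! j = w * profile j"
  shows "I_val S D (vpoint D i) = w\<^sup>2 \<longleftrightarrow> D ! i = w * profile i"
proof -
  obtain c where c: "c \<in> changes" "rank i = (i - c) + (c - i)"
    using rank_attained by blast
  have reach: "reach D i c = 2 * w * sqrt (real (rank i))"
    using i c inner by (rule reach_nearest)
  have "I_val S D (vpoint D i) = radius D i * (radius D i + reach D i c)"
    using D i c
  proof (rule I_val_vpoint)
    show "reach D i c \<le> reach D i c'" if "c' \<in> changes" for c'
      unfolding reach using D i that w inner by (rule reach_ge)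
  qed
  then have "I_val S D (vpoint D i) = w\<^sup>2 \<longleftrightarrow> radius D i = w * sqrt_step (rank i)"
    using quadratic_sqrt_step[OF radius_nonneg[OF D i] w] reach by simp
  also have "\<dots> \<longleftrightarrow> D ! i = w * profile i"
    by (auto simp: radius_def profile_def)
  finally show ?thesis .
qed

text \<open>Forwards by strong induction on the rank, starting at the changes, which have rank 0.
  Backwards every gap satisfies \<open>inner\<close> at once.\<close>

lemma values_iff:
  assumes D: "is_spacings S D" and w: "0 \<le> w"
  shows "(\<forall>i\<le>J. I_val S D (vpoint D i) = w\<^sup>2) \<longleftrightarrow> (\<forall>i\<le>J. D ! i = w * profile i)"
proof
  assume vals: "\<forall>i\<le>J. I_val S D (vpoint D i) = w\<^sup>2"
  have "i \<le> J \<Longrightarrow> D ! i = w * profile i" for i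
  proof (induction "rank i" arbitrary: i rule: less_induct)
    case less
    then show ?case
      using value_iff[OF D less.prems w] vals by auto
  qed
  then show "\<forall>i\<le>J. D ! i = w * profile i" by blast
next
  assume "\<forall>i\<le>J. D ! i = w * profile i"
  then show "\<forall>i\<le>J. I_val S D (vpoint D i) = w\<^sup>2"
    using value_iff[OF D _ w] by auto
qed

lemma local_vulnerable_points_eq: "local_vulnerable_points S D = vpoint D ` {..J}"
proof -
  have "{..J} = {0} \<union> {J} \<union> {1..<J}" by auto
  then have "vpoint D ` {..J} = {vpoint D 0} \<union> {vpoint D J} \<union> vpoint D ` {1..<J}"
    by (simp add: image_Un)
  also have "vpoint D 0 = loc D 0"
    by (simp add: vpoint_def)
  \<comment> \<open>\<open>two_le_J\<close> ensures that \<open>J\<close> does not fall into the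
    branch for \<open>0\<close>.\<close>
  also have "vpoint D J = loc D (length S - 1)"
    using two_le_J by (simp add: vpoint_def length_S)
  also have "vpoint D ` {1..<J} = (\<lambda>i. (loc D i + loc D (i + 1)) / 2) ` {1..<J}"
    by (rule image_cong) (auto simp: vpoint_def)
  also have "\<dots> = {(loc D i + loc D (i + 1)) / 2 | i. 1 \<le> i \<and> i + 2 < length S}"
    using length_S by auto
  finally show ?thesis
    by (auto simp: local_vulnerable_points_def)
qed

lemma I_val_nonneg: "0 \<le> I_val S D p"
proof -
  obtain a b where "a < length S" "b < length S" "kind_of (S ! a) = KT" "kind_of (S ! b) = KR"
    using ex_transmitter ex_receiver length_S
    by (metis add_2_eq_Suc' le_imp_less_Suc less_SucI)
  then have "I_val S D p \<in> {\<bar>loc D a - p\<bar> * \<bar>loc D b - p\<bar> | a b.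
     a < length S \<and> b < length S \<and> kind_of (S ! a) = KT \<and> kind_of (S ! b) = KR}"
    unfolding I_val_def by (intro Min_in finite_I_val_set) blast
  then show ?thesis by auto
qed

text \<open>The common value is nonnegative, hence a square \<open>w\<^sup>2\<close>; it is read off
  at \<open>Hl\<close>, which is \<open>vpoint D 0\<close>.\<close>

lemma balanced_iff:
  assumes D: "is_spacings S D"
  shows "balanced S D \<longleftrightarrow> (\<exists>w\<ge>0. \<forall>i\<le>J. D ! i = w * profile i)"
proof
  assume bal: "balanced S D"
  define w where "w = sqrt (I_val S D (vpoint D 0))"
  have "0 \<le> w" "w\<^sup>2 = I_val S D (vpoint D 0)"
    by (simp_all add: w_def I_val_nonneg)
  moreover have "I_val S D (vpoint D i) = I_val S D (vpoint D 0)" if "i \<le> J" for i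
    using bal that unfolding balanced_def local_vulnerable_points_eq by blast
  ultimately show "\<exists>w\<ge>0. \<forall>i\<le>J. D ! i = w * profile i"
    using values_iff[OF D] by metis
next
  assume "\<exists>w\<ge>0. \<forall>i\<le>J. D ! i = w * profile i"
  then show "balanced S D"
    using values_iff[OF D] by (fastforce simp: balanced_def local_vulnerable_points_eq)
qed

section \<open>The total length fixes the scale\<close>

lemma profile_pos: "0 < profile i"
  by (simp add: profile_def sqrt_step_pos)

text \<open>Balanced spacings are the nonnegative multiples of \<open>profile\<close>. The multiple
  by \<open>w\<close> has total length \<open>w * F\<close> with \<open>F > 0\<close>, so
  \<open>h\<close> forces \<open>w = h / F\<close>.\<close>

theorem ex1_balanced:
  assumes h: "h > 0"
  shows "\<exists>!D. is_spacings S D \<and> loc D (J + 1) - loc D 0 = h \<and> balanced S D"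
proof -
  define F where "F = (\<Sum>i\<le>J. profile i)"
  have F: "0 < F"
    unfolding F_def by (intro sum_pos profile_pos) auto
  have total: "loc D (J + 1) - loc D 0 = w * F"
    if "length D = J + 1" "\<forall>i\<le>J. D ! i = w * profile i" for D w
  proof -
    have "loc D (J + 1) - loc D 0 = sum ((!) D) {..J}"
      using loc_diff[of 0 "J + 1" D] that(1) by (simp add: atLeast0LessThan lessThan_Suc_atMost)
    also have "\<dots> = w * F"
      using that(2) by (simp add: F_def sum_distrib_left)
    finally show ?thesis .
  qed
  define D where "D = map (\<lambda>i. h / F * profile i) [0..<J + 1]"
  have D_nth: "length D = J + 1" "\<forall>i\<le>J. D ! i = h / F * profile i"
    by (auto simp: D_def simp del: upt_Suc)
  show ?thesis
  proof (rule ex1I[of _ D])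
    have "0 \<le> h / F * profile i" for i
      using h F profile_pos[of i] by (intro mult_nonneg_nonneg) auto
    then have D: "is_spacings S D"
      using length_S by (auto simp: is_spacings_def D_def simp del: upt_Suc)
    moreover have "0 \<le> h / F"
      using h F by simp
    then have "balanced S D"
      unfolding balanced_iff[OF D] using D_nth(2) by blast
    moreover have "loc D (J + 1) - loc D 0 = h"
      using total[OF D_nth] F by simp
    ultimately show "is_spacings S D \<and> loc D (J + 1) - loc D 0 = h \<and> balanced S D"
      by blast
  next
    fix E
    assume E: "is_spacings S E \<and> loc E (J + 1) - loc E 0 = h \<and> balanced S E"
    then obtain w where w: "\<forall>i\<le>J. E ! i = w * profile i"
      using balanced_iff by blast
    have len: "length E = J + 1"
      using E length_spacings by blast
    have "w = h / F"
      using total[OF len w] E F by (simp add: field_simps)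
    then show "E = D"
      using w len D_nth by (intro nth_equalityI) auto
  qed
qed

end

section \<open>From deployment orders to sensor lines\<close>

lemma is_order_sensor_line:
  assumes "is_order M N S" "M \<ge> 1" "N \<ge> 1"
  shows "sensor_line S (M + N)"
proof -
  obtain ss where S: "S = Hl # ss @ [Hr]" and ss: "distinct ss" "set ss = Tx ` {1..M} \<union> Rx ` {1..N}"
    using assms(1) by (auto simp: is_order_def)
  have "length ss = card (Tx ` {1..M} \<union> Rx ` {1..N})"
    using ss distinct_card by fastforce
  also have "\<dots> = card (Tx ` {1..M}) + card (Rx ` {1..N})"
    by (rule card_Un_disjoint) auto
  also have "\<dots> = M + N"
    by (simp add: card_image inj_on_def)
  finally have len: "length ss = M + N" .
  have nth: "S ! Suc k = ss ! k" if "k < M + N" for k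
    using that len by (simp add: S nth_append)
  have ex: "\<exists>i. 1 \<le> i \<and> i \<le> M + N \<and> kind_of (S ! i) = kind_of x" if x: "x \<in> set ss" for x
  proof -
    obtain k where "k < M + N" "ss ! k = x"
      using x len by (auto simp: in_set_conv_nth)
    then show ?thesis
      using nth by (intro exI[of _ "Suc k"]) auto
  qed
  show ?thesis
  proof
    show "length S = M + N + 2"
      by (simp add: S len)
    show "kind_of (S ! i) = KT \<or> kind_of (S ! i) = KR" if "1 \<le> i" "i \<le> M + N" for i
    proof -
      have k: "i = Suc (i - 1)" "i - 1 < M + N"
        using that by auto
      then have "S ! i \<in> set ss"
        using nth[of "i - 1"] len by simp
      then show ?thesis
        using ss(2) by auto
    qed
    show "kind_of (S ! 0) = KHl"
      by (simp add: S)
    show "kind_of (S ! (M + N + 1)) = KHr"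
      by (simp add: S nth_append len)
    \<comment> \<open>Since \<open>M\<close> and \<open>N\<close> are at least 1, the nodes
      \<open>Tx 1\<close> and \<open>Rx 1\<close> occur in the order.\<close>
    show "\<exists>i. 1 \<le> i \<and> i \<le> M + N \<and> kind_of (S ! i) = KT"
      using ex[of "Tx 1"] assms ss(2) by auto
    show "\<exists>i. 1 \<le> i \<and> i \<le> M + N \<and> kind_of (S ! i) = KR"
      using ex[of "Rx 1"] assms ss(2) by auto
  qed
qed

theorem corollary1:
  fixes h :: real and M N :: nat and S :: "node list"
  assumes "h > 0" and "M \<ge> 1" and "N \<ge> 1"
    and "candidate_order M N S"
  shows "\<exists>!D. is_spacings S D \<and> loc D (M + N + 1) - loc D 0 = h \<and> balanced S D"
proof -
  interpret sensor_line S "M + N"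
    using assms by (intro is_order_sensor_line) (auto simp: candidate_order_def)
  show ?thesis
    using assms(1) by (rule ex1_balanced)
qed

end
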